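(* Let $M\in\mathbb{Z}^{3\times 3}$ be non-singular. Then $\mathcal{G}(M)$ is linearly edge-transitive if and only if it is isomorphic to $\mathcal{G}(M_1)$ or $\mathcal{G}(M_1')$, where $$M_1=\begin{pmatrix} a & c & b \\ b & a & c \\ c & b & a \end{pmatrix}\quad\text{or}\quad M_1'=\begin{pmatrix} a & b & c \\ a & c & -b-c \\ a & -b-c & b \end{pmatrix}$$ for some $a,b,c\in\mathbb{Z}$ (for which the corresponding matrix is non-singular).
   Context: For a non-singular matrix $M\in\mathbb{Z}^{n\times n}$, $\mathcal{G}(M)$ denotes the undirected Cayley graph $Cay(\mathbb{Z}^n/M\mathbb{Z}^n;\pm\mathcal{B}_n)$, where $\pm\mathcal{B}_n=\{\pm\mathbf{e}_1,\dots,\pm\mathbf{e}_n\}$ and $\mathbf{e}_i$ is the $i$-th standard basis vector: the vertices are the elements of the finite Abelian group $\mathbb{Z}^n/M\mathbb{Z}^n$ (integer column vectors modulo the lattice generated by the columns of $M$), and $\mathbf{v},\mathbf{w}$ are adjacent if and only if $\mathbf{v}-\mathbf{w}\equiv\pm\mathbf{e}_i\pmod M$ for some $i$. $LAut(\mathcal{G}(M),\mathbf{0})$ denotes the group of linear automorphisms of $\mathcal{G}(M)$ fixing $\mathbf{0}$, i.e. the graph automorphisms of $\mathcal{G}(M)$ that are also group automorphisms of $\mathbb{Z}^n/M\mathbb{Z}^n$. $\mathcal{G}(M)$ is linearly edge-transitive if for every $i\in\{1,\dots,n\}$ there exists $f\in LAut(\mathcal{G}(M),\mathbf{0})$ wi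th $f(\mathbf{e}_1)=\pm\mathbf{e}_i$.
   Formalization: "Isomorphic" is taken as a graph isomorphism that is also a group isomorphism, and graph isomorphisms and automorphisms must preserve multiplicities of edges when some ±e_i coincide modulo M; with plain graph isomorphism, or plain adjacency, the claim is false. *)

theory Defs
  imports "HOL-Analysis.Analysis" "HOL-Algebra.Coset"
begin

definition Zn :: "(int ^ 'n) monoid" where
  "Zn = \<lparr>carrier = UNIV, mult = (+), one = 0\<rparr>"

definition column_lattice :: "int ^ 'n ^ 'n \<Rightarrow> (int ^ 'n) set" where
  "column_lattice M = range (\<lambda>x. M *v x)"

definition quotient_group :: "int ^ 'n ^ 'n \<Rightarrow> (int ^ 'n) set monoid" where
  "quotient_group M = Zn Mod column_lattice M"

definition residue_class :: "int ^ 'n ^ 'n \<Rightarrow> int ^ 'n \<Rightarrow> (int ^ 'n) set" where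
  "residue_class M x = column_lattice M #>\<^bsub>Zn\<^esub> x"

(* In the quotient group, v \<otimes> inv w is the difference of v and w; the vector
   s e_i is axis i s. *)
definition adjacent :: "int ^ 'n ^ 'n \<Rightarrow> (int ^ 'n) set \<Rightarrow> (int ^ 'n) set \<Rightarrow> bool" where
  "adjacent M v w \<longleftrightarrow> (\<exists>i. \<exists>s \<in> {1, -1}.
     v \<otimes>\<^bsub>quotient_group M\<^esub> inv\<^bsub>quotient_group M\<^esub> w = residue_class M (axis i s))"

(* The Cayley graph with respect to the 2n generators +e_i, -e_i. Some of
   them may coincide modulo M; coinciding generators then give parallel edges.
   The multiplicity counts the generators that join v and w. If the 2n
   generators are distinct modulo M, this is just the indicator of adjacency (see
   edge_mult_eq_adjacent below). *)
definition edge_mult :: "int ^ 'n ^ 'n \<Rightarrow> (int ^ 'n) set \<Rightarrow> (int ^ 'n) set \<Rightarrow> nat" where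
  "edge_mult M v w = card {(i, s). s \<in> {1, -1} \<and>
     v \<otimes>\<^bsub>quotient_group M\<^esub> inv\<^bsub>quotient_group M\<^esub> w = residue_class M (axis i s)}"

definition graph_isos ::
    "int ^ 'n ^ 'n \<Rightarrow> int ^ 'n ^ 'n \<Rightarrow> ((int ^ 'n) set \<Rightarrow> (int ^ 'n) set) set" where
  "graph_isos M M' = {f.
     bij_betw f (carrier (quotient_group M)) (carrier (quotient_group M')) \<and>
     (\<forall>v \<in> carrier (quotient_group M). \<forall>w \<in> carrier (quotient_group M).
        edge_mult M' (f v) (f w) = edge_mult M v w)}"

definition linear_isos ::
    "int ^ 'n ^ 'n \<Rightarrow> int ^ 'n ^ 'n \<Rightarrow> ((int ^ 'n) set \<Rightarrow> (int ^ 'n) set) set" where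
  "linear_isos M M' = graph_isos M M' \<inter> iso (quotient_group M) (quotient_group M')"

(* Group automorphisms fix the neutral element, so no separate condition on it is needed. *)
definition LAut :: "int ^ 'n ^ 'n \<Rightarrow> ((int ^ 'n) set \<Rightarrow> (int ^ 'n) set) set" where
  "LAut M = linear_isos M M"

(* For the numeral index types 2, 3, ... the index of the first basis vector is 1. *)
definition linearly_edge_transitive :: "int ^ 'n::{finite, one} ^ 'n::{finite, one} \<Rightarrow> bool" where
  "linearly_edge_transitive M \<longleftrightarrow> (\<forall>i. \<exists>f \<in> LAut M.
     f (residue_class M (axis 1 1)) \<in> {residue_class M (axis i 1), residue_class M (axis i (-1))})"

(* Plain graph isomorphism would not do: it does not preserve linear edge-transitivity
   (for example K_4 arises from Z_4 with generators 1, 2, 1 and from Z_2 x Z_2 with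
   (1,0), (0,1), (1,1); only the latter is linearly edge-transitive). *)
definition cayley_isomorphic :: "int ^ 'n ^ 'n \<Rightarrow> int ^ 'n ^ 'n \<Rightarrow> bool" where
  "cayley_isomorphic M M' \<longleftrightarrow> linear_isos M M' \<noteq> {}"

definition mat_M1 :: "int \<Rightarrow> int \<Rightarrow> int \<Rightarrow> int ^ 3 ^ 3" where
  "mat_M1 a b c = vector [vector [a, c, b],
                          vector [b, a, c],
                          vector [c, b, a]]"

definition mat_M1' :: "int \<Rightarrow> int \<Rightarrow> int \<Rightarrow> int ^ 3 ^ 3" where
  "mat_M1' a b c = vector [vector [a, b, c],
                           vector [a, c, - b - c],
                           vector [a, - b - c, b]]"

lemma edge_mult_pos_iff_adjacent: "edge_mult M v w > 0 \<longleftrightarrow> adjacent M v w"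
proof -
  let ?S = "{(i, s). s \<in> {1, -1} \<and>
     v \<otimes>\<^bsub>quotient_group M\<^esub> inv\<^bsub>quotient_group M\<^esub> w = residue_class M (axis i s)}"
  have "finite ?S"
    by (rule finite_subset[of _ "UNIV \<times> {1, -1}"]) auto
  then show ?thesis
    unfolding edge_mult_def adjacent_def by (auto simp: card_gt_0_iff)
qed

lemma edge_mult_eq_adjacent:
  assumes "inj_on (\<lambda>(i, s). residue_class M (axis i s)) (UNIV \<times> {1, -1})"
  shows "edge_mult M v w = of_bool (adjacent M v w)"
proof -
  let ?S = "{(i, s). s \<in> {1, -1} \<and>
     v \<otimes>\<^bsub>quotient_group M\<^esub> inv\<^bsub>quotient_group M\<^esub> w = residue_class M (axis i s)}"
  have "x = y" if "x \<in> ?S" "y \<in> ?S" for x y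
    by (rule inj_onD[OF assms]) (use that in auto)
  then have "card ?S \<le> 1"
    by (metis (no_types, lifting) card_le_Suc0_iff_eq One_nat_def card.infinite zero_le)
  then show ?thesis
    using edge_mult_pos_iff_adjacent[of M v w] unfolding edge_mult_def by (auto simp: of_bool_def)
qed

end

(* A linear isomorphism preserves the multiset of generators +e_i, -e_i, hence comes from a signed
   permutation of the coordinates that maps one column lattice onto the other. A linearly
   edge-transitive graph thus has a lattice that is stable under a signed 3-cycle, and after changing
   signs of coordinates under the cyclic shift C of Z^3. Such a lattice is an ideal of
   Z[x]/(x^3 - 1) of full rank. Since the vectors of coordinate sum zero form a module over the
   principal ideal domain Z[omega], it is either generated by one vector and its shifts (M_1), or
   it is the direct sum of its invariant part and of its part of sum zero (M_1'). *)
theory Submission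
  imports Defs "HOL-Combinatorics.Permutations"
begin

section \<open>Linear isomorphisms and signed permutations\<close>

text \<open>Different generators may lie in the same class modulo \<open>M\<close>, and a class may
  be its own negative. An isomorphism then does not determine a permutation of the coordinates; it
  only preserves how many generators fall into each class. So the permutation has to be produced by
  counting, with freedom wherever generators coincide. The signs are under control because -1
  preserves every lattice and, in dimension three, flips the product of the signs, so that the
  signed 3-cycle can be chosen with cube equal to the identity. There are two families of matrices
  because \<int>[x]/(x^3 - 1) is a subring of index 3 in \<int> \<times> \<int>[\<omega>]: an ideal
  of full rank either splits along the two factors or is glued modulo the prime 1 - \<omega> above
  3.\<close>

lemma column_lattice_zero: "0 \<in> column_lattice M"
  unfolding column_lattice_def by (metis matrix_vector_mult_0_right rangeI)

lemma column_lattice_diff: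
  "x \<in> column_lattice M \<Longrightarrow> y \<in> column_lattice M \<Longrightarrow> x - y \<in> column_lattice M"
  unfolding column_lattice_def by (auto simp flip: matrix_vector_mult_diff_distrib)

lemma column_lattice_uminus_iff: "- x \<in> column_lattice M \<longleftrightarrow> x \<in> column_lattice M"
  using column_lattice_diff[OF column_lattice_zero[of M]] by fastforce

lemma column_lattice_add:
  "x \<in> column_lattice M \<Longrightarrow> y \<in> column_lattice M \<Longrightarrow> x + y \<in> column_lattice M"
  using column_lattice_diff[of x M "- y"] by (simp add: column_lattice_uminus_iff)

lemma comm_group_Zn: "comm_group (Zn :: (int ^ 'n) monoid)"
  by (rule comm_groupI) (auto simp: Zn_def algebra_simps intro: exI[of _ "- _"])

lemma normal_column_lattice: "column_lattice M \<lhd> Zn"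
proof -
  interpret comm_group Zn by (rule comm_group_Zn)
  have inv: "inv\<^bsub>Zn\<^esub> x = - x" for x :: "int ^ 'n"
    by (rule inv_equality) (auto simp: Zn_def)
  have "subgroup (column_lattice M) Zn"
    using column_lattice_zero[of M] unfolding Zn_def
    by (intro subgroup.intro)
       (auto simp: inv[unfolded Zn_def] column_lattice_add column_lattice_uminus_iff)
  then show ?thesis by (rule subgroup_imp_normal)
qed

lemma residue_class_eq: "residue_class M x = {y. y - x \<in> column_lattice M}"
  by (force simp: residue_class_def r_coset_def Zn_def)

lemma residue_class_eq_iff:
  "residue_class M x = residue_class M y \<longleftrightarrow> x - y \<in> column_lattice M"
proof
  assume "residue_class M x = residue_class M y"
  moreover have "x \<in> residue_class M x" by (simp add: residue_class_eq column_lattice_zero)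
  ultimately show "x - y \<in> column_lattice M" by (simp add: residue_class_eq)
next
  assume "x - y \<in> column_lattice M"
  then show "residue_class M x = residue_class M y"
    using column_lattice_add[of _ M "x - y"] column_lattice_diff[of _ M "x - y"]
    by (fastforce simp: residue_class_eq)
qed

lemma residue_class_uminus: "residue_class M (- x) = uminus ` residue_class M x"
proof -
  have "y \<in> residue_class M (- x) \<longleftrightarrow> - y \<in> residue_class M x" for y
    using column_lattice_uminus_iff[of "y + x" M] by (simp add: residue_class_eq)
  then show ?thesis by (force simp: image_iff intro: bexI[of _ "- _"])
qed

lemma carrier_quotient_group: "carrier (quotient_group M) = range (residue_class M)"
  by (auto simp: quotient_group_def FactGroup_def RCOSETS_def residue_class_def Zn_def)

lemma quotient_group_mult:
  "residue_class M x \<otimes>\<^bsub>quotient_group M\<^esub> residue_class M y = residue_class M (x + y)"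
  using normal.rcos_sum[OF normal_column_lattice, of x y M]
  by (simp add: quotient_group_def FactGroup_def residue_class_def Zn_def)

lemma group_quotient_group: "group (quotient_group M)"
  unfolding quotient_group_def by (rule normal.factorgroup_is_group[OF normal_column_lattice])

lemma quotient_group_inv:
  "inv\<^bsub>quotient_group M\<^esub> residue_class M x = residue_class M (- x)"
proof -
  interpret group "quotient_group M" by (rule group_quotient_group)
  have "residue_class M 0 \<otimes>\<^bsub>quotient_group M\<^esub> residue_class M 0 = residue_class M 0"
    by (simp add: quotient_group_mult)
  then have "residue_class M 0 = \<one>\<^bsub>quotient_group M\<^esub>"
    by (metis r_cancel_one carrier_quotient_group rangeI)
  then show ?thesis
    by (intro inv_equality) (auto simp: carrier_quotient_group quotient_group_mult)
qed

section \<open>Counting generators with multiplicity\<close>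

lemma edge_mult_residue_class:
  "edge_mult M (residue_class M x) (residue_class M y) =
     card {(i, s). s \<in> {1, -1} \<and> residue_class M (axis i s) = residue_class M (x - y)}"
  unfolding edge_mult_def quotient_group_inv quotient_group_mult
  by (simp add: eq_commute)

text \<open>The function \<open>h\<close> is the isomorphism when images of generators are counted
  and the identity for the generators of the target, so both sides of the matching have the same
  shape.\<close>

lemma card_signed_axis:
  fixes M :: "int ^ 'n ^ 'n"
  shows "card {(i, s). s \<in> {1, -1} \<and> h (residue_class M (axis i s)) = y} =
    card {i. h (residue_class M (axis i 1)) = y} + card {i. h (residue_class M (axis i (-1))) = y}"
proof -
  let ?S = "\<lambda>s. {i. h (residue_class M (axis i s)) = y}"
  have "{(i, s). s \<in> {1, -1} \<and> h (residue_class M (axis i s)) = y} =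
    ?S 1 \<times> {1} \<union> ?S (-1) \<times> {-1}" by auto
  also have "card \<dots> = card (?S 1 \<times> {1::int}) + card (?S (-1) \<times> {-1::int})"
    by (rule card_Un_disjoint) auto
  finally show ?thesis by (simp add: card_cartesian_product)
qed

text \<open>The sum of the two counts at \<open>y\<close> is the number of indices with value in the
  orbit {y, \<nu> y}, doubled if \<open>\<nu>\<close> fixes \<open>y\<close>. The factor depends on
  \<open>y\<close> only, so \<open>A\<close> and \<open>B\<close> meet every orbit equally often,
  and the multisets of orbits agree. In the application \<open>\<nu>\<close> is negation of
  classes.\<close>

lemma signed_matching:
  fixes A B :: "'n::finite \<Rightarrow> 'k"
  assumes inv: "\<And>y. \<nu> (\<nu> y) = y"
    and cards: "\<And>y. card {i. A i = y} + card {i. \<nu> (A i) = y} = card {i. B i = y} + card {i. \<nu> (B i) = y}"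
  shows "\<exists>p. bij p \<and> (\<forall>j. {B j, \<nu> (B j)} = {A (p j), \<nu> (A (p j))})"
proof -
  define key where "key y = {y, \<nu> y}" for y
  have key_eq: "key z = key y \<longleftrightarrow> z = y \<or> \<nu> z = y" for y z
    unfolding key_def using inv by (metis doubleton_eq_iff)
  have two: "card {i. D i = y} + card {i. \<nu> (D i) = y} =
      (if \<nu> y = y then 2 else 1) * card {i. key (D i) = key y}" for D :: "'n \<Rightarrow> 'k" and y
  proof (cases "\<nu> y = y")
    case True
    then have "{i. \<nu> (D i) = y} = {i. D i = y}" by (metis inv)
    moreover from this have "{i. key (D i) = key y} = {i. D i = y}" unfolding key_eq by blast
    ultimately show ?thesis using True by simp
  next
    case False
    have "card {i. key (D i) = key y} = card ({i. D i = y} \<union> {i. \<nu> (D i) = y})"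
      unfolding key_eq by (rule arg_cong[of _ _ card]) auto
    also have "\<dots> = card {i. D i = y} + card {i. \<nu> (D i) = y}"
      using False by (intro card_Un_disjoint) auto
    finally show ?thesis using False by simp
  qed
  have fib: "card {i. key (A i) = K} = card {i. key (B i) = K}" for K
  proof (cases "K \<in> range key")
    case True
    then obtain y where "K = key y" by auto
    then show ?thesis using cards[of y] two[of A y] two[of B y] by (auto split: if_splits)
  next
    case False
    then have "{i. key (A i) = K} = {}" "{i. key (B i) = K} = {}" by auto
    then show ?thesis by simp
  qed
  have "image_mset (\<lambda>i. key (B i)) (mset_set UNIV) = image_mset (\<lambda>i. key (A i)) (mset_set UNIV)"
    by (rule multiset_eqI) (simp add: count_image_mset fib vimage_def)
  then obtain p where "p permutes UNIV" "\<forall>i\<in>UNIV. key (B i) = key (A (p i))"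
    by (rule image_mset_eq_implies_permutes[rotated]) auto
  then show ?thesis unfolding key_def using permutes_bij by blast
qed

section \<open>Signed permutations between lattices\<close>

text \<open>Coordinates are pulled back along \<open>\<tau>\<close>: the basis vector with index
  \<open>\<tau> j\<close> goes to plus or minus the one with index \<open>j\<close>, and composition
  reverses the order of the permutations.\<close>

definition signed_perm :: "('n \<Rightarrow> 'n) \<Rightarrow> ('n \<Rightarrow> int) \<Rightarrow> int ^ 'n \<Rightarrow> int ^ 'n" where
  "signed_perm \<tau> \<epsilon> x = (\<chi> j. \<epsilon> j * x $ \<tau> j)"

definition lattice_iso ::
    "int ^ 'n ^ 'n \<Rightarrow> int ^ 'n ^ 'n \<Rightarrow> ('n \<Rightarrow> 'n) \<Rightarrow> ('n \<Rightarrow> int) \<Rightarrow> bool" where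
  "lattice_iso M M' \<tau> \<epsilon> \<longleftrightarrow> bij \<tau> \<and> range \<epsilon> \<subseteq> {1, -1} \<and>
     (\<forall>x. signed_perm \<tau> \<epsilon> x \<in> column_lattice M' \<longleftrightarrow> x \<in> column_lattice M)"

lemma signed_perm_zero: "signed_perm \<tau> \<epsilon> 0 = 0"
  and signed_perm_add: "signed_perm \<tau> \<epsilon> (x + y) = signed_perm \<tau> \<epsilon> x + signed_perm \<tau> \<epsilon> y"
  and signed_perm_diff: "signed_perm \<tau> \<epsilon> (x - y) = signed_perm \<tau> \<epsilon> x - signed_perm \<tau> \<epsilon> y"
  and signed_perm_uminus: "signed_perm \<tau> \<epsilon> (- x) = - signed_perm \<tau> \<epsilon> x"
  by (simp_all add: signed_perm_def vec_eq_iff algebra_simps)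

lemma signed_perm_axis:
  assumes "inj \<tau>"
  shows "signed_perm \<tau> \<epsilon> (axis (\<tau> j) s) = axis j (\<epsilon> j * s)"
  using assms by (auto simp: signed_perm_def axis_def vec_eq_iff inj_eq)

lemma signed_perm_comp:
  "signed_perm \<tau>' \<epsilon>' (signed_perm \<tau> \<epsilon> x) = signed_perm (\<tau> \<circ> \<tau>') (\<lambda>j. \<epsilon>' j * \<epsilon> (\<tau>' j)) x"
  by (simp add: signed_perm_def mult.assoc)

lemma lattice_iso_trans:
  assumes "lattice_iso M M' \<tau> \<epsilon>" "lattice_iso M' M'' \<tau>' \<epsilon>'"
  shows "lattice_iso M M'' (\<tau> \<circ> \<tau>') (\<lambda>j. \<epsilon>' j * \<epsilon> (\<tau>' j))"
proof -
  have "\<epsilon>' j * \<epsilon> (\<tau>' j) \<in> {1, -1}" for j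
  proof -
    have "\<epsilon>' j \<in> {1, -1}" "\<epsilon> (\<tau>' j) \<in> {1, -1}"
      using assms unfolding lattice_iso_def by blast+
    then show ?thesis by auto
  qed
  then show ?thesis
    using assms by (auto simp: lattice_iso_def bij_comp simp flip: signed_perm_comp)
qed

lemma signed_perm_inverse:
  assumes "bij \<tau>" "range \<epsilon> \<subseteq> {1, -1}"
  shows "signed_perm \<tau> \<epsilon> (signed_perm (inv_into UNIV \<tau>) (\<epsilon> \<circ> inv_into UNIV \<tau>) x) = x"
proof -
  have "\<epsilon> j \<in> {1, -1}" for j using assms by auto
  then have "\<epsilon> j * \<epsilon> j = 1" for j by (metis insertE mult_1 mult_minus1 empty_iff minus_minus)
  then show ?thesis
    using assms by (simp add: signed_perm_def vec_eq_iff bij_is_inj flip: mult.assoc)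
qed

lemma lattice_iso_sym:
  assumes "lattice_iso M M' \<tau> \<epsilon>"
  shows "lattice_iso M' M (inv_into UNIV \<tau>) (\<epsilon> \<circ> inv_into UNIV \<tau>)"
proof -
  have \<tau>: "bij \<tau>" and \<epsilon>: "\<epsilon> j \<in> {1, -1}" for j
    using assms by (auto simp: lattice_iso_def)
  then have "signed_perm \<tau> \<epsilon> (signed_perm (inv_into UNIV \<tau>) (\<epsilon> \<circ> inv_into UNIV \<tau>) x) = x" for x
    by (intro signed_perm_inverse) auto
  with assms \<tau> \<epsilon> show ?thesis
    unfolding lattice_iso_def by (metis bij_imp_bij_inv comp_apply image_subsetI)
qed

lemma signed_perm_image_residue_class:
  assumes "lattice_iso M M' \<tau> \<epsilon>"
  shows "signed_perm \<tau> \<epsilon> ` residue_class M x = residue_class M' (signed_perm \<tau> \<epsilon> x)"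
proof -
  have surj: "surj (signed_perm \<tau> \<epsilon>)"
    using assms unfolding lattice_iso_def by (metis signed_perm_inverse surjI)
  have "signed_perm \<tau> \<epsilon> y \<in> residue_class M' (signed_perm \<tau> \<epsilon> x) \<longleftrightarrow> y \<in> residue_class M x" for y
    using assms by (simp add: residue_class_eq lattice_iso_def flip: signed_perm_diff)
  then show ?thesis using surj by (force simp: image_iff surj_def)
qed

lemma linear_iso_of_lattice_iso:
  fixes M M' :: "int ^ 'n ^ 'n"
  assumes iso: "lattice_iso M M' \<tau> \<epsilon>"
  shows "image (signed_perm \<tau> \<epsilon>) \<in> linear_isos M M'"
proof -
  let ?P = "signed_perm \<tau> \<epsilon>"
  note cls = signed_perm_image_residue_class[OF iso]
  have \<tau>: "bij \<tau>" and \<epsilon>: "\<epsilon> j \<in> {1, -1}"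
    and L: "?P x \<in> column_lattice M' \<longleftrightarrow> x \<in> column_lattice M" for j x
    using iso by (auto simp: lattice_iso_def)
  have \<epsilon>2: "\<epsilon> j * (\<epsilon> j * s) = s" for j s using \<epsilon>[of j] by auto
  have "bij_betw ((`) ?P) (carrier (quotient_group M)) (carrier (quotient_group M'))"
  proof (rule bij_betw_imageI)
    show "inj_on ((`) ?P) (carrier (quotient_group M))"
      unfolding inj_on_def carrier_quotient_group ball_simps cls residue_class_eq_iff
        signed_perm_diff[symmetric] L by simp
    have "surj ?P"
      using iso unfolding lattice_iso_def by (metis signed_perm_inverse surjI)
    have "range (\<lambda>x. residue_class M' (?P x)) = residue_class M' ` range ?P"
      by (simp only: image_image)
    with \<open>surj ?P\<close> show "(`) ?P ` carrier (quotient_group M) = carrier (quotient_group M')"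
      by (simp only: carrier_quotient_group image_image cls)
  qed
  moreover have "edge_mult M' (?P ` v) (?P ` w) = edge_mult M v w"
    if "v \<in> carrier (quotient_group M)" "w \<in> carrier (quotient_group M)" for v w
  proof -
    obtain x y where v: "v = residue_class M x" and w: "w = residue_class M y"
      using \<open>v \<in> _\<close> \<open>w \<in> _\<close> unfolding carrier_quotient_group by blast
    have key: "residue_class M' (axis j s) = residue_class M' (?P (x - y)) \<longleftrightarrow>
        residue_class M (axis (\<tau> j) (\<epsilon> j * s)) = residue_class M (x - y)" for j s
      using signed_perm_axis[OF bij_is_inj[OF \<tau>], of \<epsilon> j "\<epsilon> j * s"]
      by (metis residue_class_eq_iff L signed_perm_diff \<epsilon>2)
    \<comment> \<open>The bijection acts on pairs of index and sign rather than on classes, so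
      multiplicities agree even where generators coincide modulo the lattice.\<close>
    have "bij_betw (\<lambda>(j, s). (\<tau> j, \<epsilon> j * s))
       {(i, s). s \<in> {1, -1} \<and> residue_class M' (axis i s) = residue_class M' (?P (x - y))}
       {(i, s). s \<in> {1, -1} \<and> residue_class M (axis i s) = residue_class M (x - y)}"
      (is "bij_betw _ ?S' ?S")
    proof (rule bij_betw_byWitness[where f' = "\<lambda>(i, s). (inv_into UNIV \<tau> i, \<epsilon> (inv_into UNIV \<tau> i) * s)"])
      have sgn: "\<epsilon> j * s \<in> {1, -1} \<longleftrightarrow> s \<in> {1, -1}" for j s using \<epsilon>[of j] by auto
      have inv: "inv_into UNIV \<tau> (\<tau> j) = j" "\<tau> (inv_into UNIV \<tau> j) = j" for j
        using \<tau> by (simp_all add: bij_is_inj bij_is_surj surj_f_inv_f)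
      show "\<forall>a\<in>?S'. (case case a of (j, s) \<Rightarrow> (\<tau> j, \<epsilon> j * s) of (i, s) \<Rightarrow> (inv_into UNIV \<tau> i, \<epsilon> (inv_into UNIV \<tau> i) * s)) = a"
        "\<forall>a'\<in>?S. (case case a' of (i, s) \<Rightarrow> (inv_into UNIV \<tau> i, \<epsilon> (inv_into UNIV \<tau> i) * s) of (j, s) \<Rightarrow> (\<tau> j, \<epsilon> j * s)) = a'"
        by (auto simp: inv \<epsilon>2)
      show "(\<lambda>(j, s). (\<tau> j, \<epsilon> j * s)) ` ?S' \<subseteq> ?S"
        unfolding image_subset_iff by (simp only: Ball_def split_paired_All mem_Collect_eq case_prod_conv sgn key) blast
      show "(\<lambda>(i, s). (inv_into UNIV \<tau> i, \<epsilon> (inv_into UNIV \<tau> i) * s)) ` ?S \<subseteq> ?S'"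
        unfolding image_subset_iff by (simp only: Ball_def split_paired_All mem_Collect_eq case_prod_conv sgn key inv \<epsilon>2) blast
    qed
    then show ?thesis
      unfolding v w cls edge_mult_residue_class signed_perm_diff[symmetric] by (rule bij_betw_same_card)
  qed
  moreover have "(`) ?P \<in> hom (quotient_group M) (quotient_group M')"
  proof (rule homI)
    show "?P ` v \<in> carrier (quotient_group M')" if "v \<in> carrier (quotient_group M)" for v
    proof -
      obtain x where v: "v = residue_class M x"
        using \<open>v \<in> _\<close> unfolding carrier_quotient_group by blast
      show ?thesis unfolding v cls carrier_quotient_group by (rule rangeI)
    qed
    show "?P ` (v \<otimes>\<^bsub>quotient_group M\<^esub> w) = ?P ` v \<otimes>\<^bsub>quotient_group M'\<^esub> ?P ` w"
      if "v \<in> carrier (quotient_group M)" "w \<in> carrier (quotient_group M)" for v w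
    proof -
      obtain x y where v: "v = residue_class M x" and w: "w = residue_class M y"
        using \<open>v \<in> _\<close> \<open>w \<in> _\<close> unfolding carrier_quotient_group by blast
      show ?thesis unfolding v w quotient_group_mult cls signed_perm_add ..
    qed
  qed
  ultimately show ?thesis
    by (auto simp: linear_isos_def graph_isos_def iso_def)
qed

section \<open>From a linear isomorphism to a signed permutation\<close>

text \<open>Serves as an induction principle: two maps that are additive modulo a lattice agree
  modulo it as soon as they agree on the basis vectors.\<close>

lemma subgroup_with_axes_eq_UNIV:
  fixes S :: "(int ^ 'n) set"
  assumes "0 \<in> S" "\<And>x y. x \<in> S \<Longrightarrow> y \<in> S \<Longrightarrow> x + y \<in> S" "\<And>x. x \<in> S \<Longrightarrow> - x \<in> S"
    and "\<And>i. axis i 1 \<in> S"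
  shows "x \<in> S"
proof -
  have "axis i k \<in> S" for i k
  proof (induction k rule: int_induct[where k = 0])
    case base
    show ?case using assms(1) axis_eq_0_iff[of i "0 :: int"] by metis
  next
    case (step1 k)
    have "axis i (k + 1) = axis i k + (axis i 1 :: int ^ 'n)" by (simp add: axis_def vec_eq_iff)
    then show ?case using step1 assms by simp
  next
    case (step2 k)
    have "axis i (k - 1) = axis i k + - (axis i 1 :: int ^ 'n)" by (simp add: axis_def vec_eq_iff)
    then show ?case using step2 assms by metis
  qed
  moreover have "(\<Sum>i\<in>A. g i) \<in> S" if "finite A" "\<And>i. g i \<in> S" for g and A :: "'n set"
    using that by (induction A rule: finite_induct) (auto intro: assms)
  moreover have "x = (\<Sum>i\<in>UNIV. axis i (x $ i))"
    by (simp add: vec_eq_iff axis_def)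
  ultimately show ?thesis by (metis finite)
qed

text \<open>The map \<open>g\<close> is an arbitrary choice of representatives, hence additive only
  modulo the lattice of \<open>M'\<close>.\<close>

lemma linear_iso_lift:
  fixes M M' :: "int ^ 'n ^ 'n"
  assumes f: "f \<in> linear_isos M M'"
  obtains g where "\<And>x. f (residue_class M x) = residue_class M' (g x)"
    "\<And>x y. residue_class M' (g (x + y)) = residue_class M' (g x + g y)"
    "\<And>x. residue_class M' (g (- x)) = residue_class M' (- g x)"
proof -
  let ?c = "residue_class M" and ?c' = "residue_class M'"
  have bij: "bij_betw f (range ?c) (range ?c')"
    and hom: "f \<in> hom (quotient_group M) (quotient_group M')"
    using f by (auto simp: linear_isos_def graph_isos_def iso_def carrier_quotient_group)
  have "\<exists>g. \<forall>x. f (?c x) = ?c' (g x)"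
    using bij unfolding bij_betw_def by (intro choice) (metis imageE image_eqI rangeI)
  then obtain g where g: "\<And>x. f (?c x) = ?c' (g x)" by blast
  have add: "?c' (g (x + y)) = ?c' (g x + g y)" for x y
    using hom_mult[OF hom, of "?c x" "?c y"]
    by (simp add: carrier_quotient_group quotient_group_mult g)
  have "?c' (g (- x)) = ?c' (- g x)" for x
  proof -
    have "?c' (g 0 - g x) = ?c' (g (- x))"
      using add[of "- x" x] by (simp add: residue_class_eq_iff diff_diff_eq add.commute)
    moreover have "?c' (- g x) = ?c' (g 0 - g x)"
      using add[of 0 0] by (simp add: residue_class_eq_iff)
    ultimately show ?thesis by simp
  qed
  with g add show ?thesis by (rule that)
qed

lemma linear_iso_inj:
  assumes "f \<in> linear_isos M M'"
  shows "f (residue_class M x) = f (residue_class M y) \<longleftrightarrow> residue_class M x = residue_class M y"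
  using assms
  by (auto simp: linear_isos_def graph_isos_def carrier_quotient_group bij_betw_def inj_on_eq_iff)

definition sign_orbit :: "(int ^ 'n) set \<Rightarrow> (int ^ 'n) set set" where
  "sign_orbit c = {c, uminus ` c}"

lemma uminus_image_uminus: "uminus ` uminus ` c = (c :: (int ^ 'n) set)"
  by (simp add: image_image)

lemma sign_orbit_eq_iff: "sign_orbit c = sign_orbit d \<longleftrightarrow> c = d \<or> c = uminus ` d"
  unfolding sign_orbit_def by (metis doubleton_eq_iff uminus_image_uminus)

lemma axis_uminus: "axis i (- 1) = - (axis i 1 :: int ^ 'n)"
  by (simp add: axis_def vec_eq_iff)

text \<open>The edge multiplicity between the class of \<open>x\<close> and the neutral class counts
  the generators in the class of \<open>x\<close>. As \<open>f\<close> preserves it, images of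
  generators and generators of the target are equally frequent in every class. A permutation can
  match them only up to sign.\<close>

lemma linear_iso_generators:
  fixes M M' :: "int ^ 'n ^ 'n"
  assumes f: "f \<in> linear_isos M M'"
  shows "\<exists>p. bij p \<and> (\<forall>j. sign_orbit (residue_class M' (axis j 1)) =
    sign_orbit (f (residue_class M (axis (p j) 1))))"
proof -
  let ?c = "residue_class M" and ?c' = "residue_class M'"
  have surj: "f ` range ?c = range ?c'"
    and em: "\<And>x y. edge_mult M' (f (?c x)) (f (?c y)) = edge_mult M (?c x) (?c y)"
    using f by (auto simp: linear_isos_def graph_isos_def bij_betw_def carrier_quotient_group)
  note inj = linear_iso_inj[OF f]
  obtain g where g: "\<And>x. f (?c x) = ?c' (g x)"
    and add: "\<And>x y. ?c' (g (x + y)) = ?c' (g x + g y)"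
    and um: "\<And>x. ?c' (g (- x)) = ?c' (- g x)"
    using linear_iso_lift[OF f] by metis
  define A where "A i = f (?c (axis i 1))" for i
  define B where "B i = ?c' (axis i 1)" for i
  have A': "f (?c (axis i (-1))) = image uminus (A i)" for i
    by (metis A_def axis_uminus g um residue_class_uminus)
  have B': "?c' (axis i (-1)) = image uminus (B i)" for i
    by (simp add: B_def axis_uminus residue_class_uminus)
  have "\<exists>p. bij p \<and> (\<forall>j. {B j, image uminus (B j)} = {A (p j), image uminus (A (p j))})"
  proof (rule signed_matching)
    show "image uminus (image uminus y) = y" for y :: "(int ^ 'n) set" by (rule uminus_image_uminus)
    fix y
    show "card {i. A i = y} + card {i. image uminus (A i) = y} =
          card {i. B i = y} + card {i. image uminus (B i) = y}"
    proof (cases "y \<in> range ?c'")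
      case True
      then obtain x where x: "y = f (?c x)" using surj by (metis imageE)
      have "card {i. A i = y} + card {i. image uminus (A i) = y} =
          card {(i, s). s \<in> {1, -1} \<and> f (?c (axis i s)) = y}"
        unfolding card_signed_axis A' A_def ..
      also have "\<dots> = edge_mult M (?c x) (?c 0)"
        by (simp add: edge_mult_residue_class inj x)
      also have "\<dots> = edge_mult M' (f (?c x)) (f (?c 0))" by (simp add: em)
      also have "\<dots> = card {(i, s). s \<in> {1, -1} \<and> ?c' (axis i s) = y}"
      proof -
        \<comment> \<open>The vector \<open>g 0\<close> represents the neutral class but may differ
          from zero.\<close>
        have "?c' (g x - g 0) = ?c' (g x)"
          using add[of 0 0] by (simp add: residue_class_eq_iff)
        then show ?thesis unfolding x g edge_mult_residue_class by simp
      qed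
      also have "\<dots> = card {i. B i = y} + card {i. image uminus (B i) = y}"
        unfolding card_signed_axis[of "\<lambda>c. c" M' y] B' B_def ..
      finally show ?thesis .
    next
      \<comment> \<open>The counts are compared at every set of vectors, also at sets that are not
        residue classes; there all of them vanish.\<close>
      case False
      moreover have "A i \<in> range ?c'" "image uminus (A i) \<in> range ?c'"
        "B i \<in> range ?c'" "image uminus (B i) \<in> range ?c'" for i
        unfolding A'[symmetric] B'[symmetric] unfolding g A_def B_def by (rule rangeI)+
      ultimately have "{i. A i = y} = {}" "{i. image uminus (A i) = y} = {}"
        "{i. B i = y} = {}" "{i. image uminus (B i) = y} = {}" by auto
      then show ?thesis by simp
    qed
  qed
  then show ?thesis unfolding sign_orbit_def A_def B_def .
qed

text \<open>With suitable signs, \<open>f\<close> and the signed permutation agree on the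
  generators, hence everywhere modulo \<open>M'\<close>. Since \<open>f\<close> is injective, the
  lattice of \<open>M\<close> consists of the vectors whose class \<open>f\<close> sends to the
  neutral class, that is, of those that the signed permutation sends into the lattice of
  \<open>M'\<close>.\<close>

lemma lattice_iso_of_generators:
  fixes M M' :: "int ^ 'n ^ 'n"
  assumes f: "f \<in> linear_isos M M'" and \<tau>: "bij \<tau>"
    and gens: "\<And>j. sign_orbit (residue_class M' (axis j 1)) =
      sign_orbit (f (residue_class M (axis (\<tau> j) 1)))"
  shows "\<exists>\<epsilon>. lattice_iso M M' \<tau> \<epsilon>"
proof -
  let ?c = "residue_class M" and ?c' = "residue_class M'"
  obtain g where g: "\<And>x. f (?c x) = ?c' (g x)"
    and add: "\<And>x y. ?c' (g (x + y)) = ?c' (g x + g y)"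
    and um: "\<And>x. ?c' (g (- x)) = ?c' (- g x)"
    using linear_iso_lift[OF f] by metis
  have "\<exists>e. e \<in> {1, -1 :: int} \<and> f (?c (axis (\<tau> j) 1)) = ?c' (axis j e)" for j
    using gens[of j] unfolding sign_orbit_eq_iff
    by (metis axis_uminus residue_class_uminus uminus_image_uminus insertCI)
  then obtain \<epsilon> where \<epsilon>: "\<And>j. \<epsilon> j \<in> {1, -1 :: int}"
      "\<And>j. f (?c (axis (\<tau> j) 1)) = ?c' (axis j (\<epsilon> j))"
    by metis
  have gP: "x \<in> {x. ?c' (g x) = ?c' (signed_perm \<tau> \<epsilon> x)}" for x
  proof (rule subgroup_with_axes_eq_UNIV)
    show "0 \<in> {x. ?c' (g x) = ?c' (signed_perm \<tau> \<epsilon> x)}"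
      using add[of 0 0] column_lattice_uminus_iff[of "g 0" M']
      by (simp add: signed_perm_zero residue_class_eq_iff)
    fix x y
    assume x: "x \<in> {x. ?c' (g x) = ?c' (signed_perm \<tau> \<epsilon> x)}"
    then show "- x \<in> {x. ?c' (g x) = ?c' (signed_perm \<tau> \<epsilon> x)}"
      by (simp add: um signed_perm_uminus residue_class_uminus)
    assume "y \<in> {x. ?c' (g x) = ?c' (signed_perm \<tau> \<epsilon> x)}"
    with x show "x + y \<in> {x. ?c' (g x) = ?c' (signed_perm \<tau> \<epsilon> x)}"
      by (simp add: add signed_perm_add flip: quotient_group_mult)
  next
    fix i
    have "\<tau> (inv_into UNIV \<tau> i) = i" using \<tau> by (simp add: bij_is_surj surj_f_inv_f)
    then show "axis i 1 \<in> {x. ?c' (g x) = ?c' (signed_perm \<tau> \<epsilon> x)}"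
      using signed_perm_axis[OF bij_is_inj[OF \<tau>(1)], of \<epsilon> "inv_into UNIV \<tau> i" 1]
        \<epsilon>(2)[of "inv_into UNIV \<tau> i"]
      by (simp add: g)
  qed
  have "signed_perm \<tau> \<epsilon> x \<in> column_lattice M' \<longleftrightarrow> x \<in> column_lattice M" for x
  proof -
    have "x \<in> column_lattice M \<longleftrightarrow> f (?c x) = f (?c 0)"
      by (simp add: linear_iso_inj[OF f] residue_class_eq_iff)
    also have "\<dots> \<longleftrightarrow> ?c' (signed_perm \<tau> \<epsilon> x) = ?c' (signed_perm \<tau> \<epsilon> 0)"
      using gP by (simp add: g)
    finally show ?thesis by (simp add: residue_class_eq_iff signed_perm_zero)
  qed
  then show ?thesis using \<tau> \<epsilon> by (auto simp: lattice_iso_def)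
qed

lemma cayley_isomorphic_iff: "cayley_isomorphic M M' \<longleftrightarrow> (\<exists>\<tau> \<epsilon>. lattice_iso M M' \<tau> \<epsilon>)"
proof
  assume "cayley_isomorphic M M'"
  then obtain f where f: "f \<in> linear_isos M M'" unfolding cayley_isomorphic_def by blast
  then show "\<exists>\<tau> \<epsilon>. lattice_iso M M' \<tau> \<epsilon>"
    using linear_iso_generators[OF f] lattice_iso_of_generators[OF f] by blast
next
  assume "\<exists>\<tau> \<epsilon>. lattice_iso M M' \<tau> \<epsilon>"
  then show "cayley_isomorphic M M'"
    unfolding cayley_isomorphic_def using linear_iso_of_lattice_iso by blast
qed

text \<open>Distinct basis vectors may coincide up to sign modulo \<open>M\<close>, so an automorphism that maps the
  first basis vector to plus or minus the \<open>i\<close>-th may come from a signed permutation that does not;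
  composing with a transposition of coinciding generators repairs this.\<close>
lemma linearly_edge_transitive_iff:
  fixes M :: "int ^ 'n::{finite, one} ^ 'n::{finite, one}"
  shows "linearly_edge_transitive M \<longleftrightarrow> (\<forall>i. \<exists>\<tau> \<epsilon>. lattice_iso M M \<tau> \<epsilon> \<and> \<tau> i = 1)"
proof (intro iffI allI)
  fix i :: 'n
  assume "linearly_edge_transitive M"
  then obtain f where f: "f \<in> linear_isos M M"
    and "f (residue_class M (axis 1 1)) \<in> {residue_class M (axis i 1), residue_class M (axis i (-1))}"
    unfolding linearly_edge_transitive_def LAut_def by blast
  then have fi: "sign_orbit (f (residue_class M (axis 1 1))) = sign_orbit (residue_class M (axis i 1))"
    by (simp add: sign_orbit_eq_iff axis_uminus residue_class_uminus)
  obtain p where p: "bij p" and gens: "\<And>j. sign_orbit (residue_class M (axis j 1)) =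
      sign_orbit (f (residue_class M (axis (p j) 1)))"
    using linear_iso_generators[OF f] by blast
  obtain j where j: "p j = 1" using p by (metis bij_pointE)
  \<comment> \<open>Up to sign, the classes of the generators \<open>i\<close> and \<open>j\<close>
    are both the image of the first one, so exchanging the two indices keeps the matching
    valid.\<close>
  define \<tau> where "\<tau> = p \<circ> Transposition.transpose i j"
  have "bij \<tau>" using p by (simp add: \<tau>_def bij_comp)
  moreover have "sign_orbit (residue_class M (axis l 1)) =
      sign_orbit (f (residue_class M (axis (\<tau> l) 1)))" for l
    using gens[of l] gens[of i] gens[of j] fi j
    by (simp add: \<tau>_def Transposition.transpose_def)
  ultimately have "\<exists>\<epsilon>. lattice_iso M M \<tau> \<epsilon>" by (rule lattice_iso_of_generators[OF f])
  moreover have "\<tau> i = 1" by (simp add: \<tau>_def j)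
  ultimately show "\<exists>\<tau> \<epsilon>. lattice_iso M M \<tau> \<epsilon> \<and> \<tau> i = 1" by blast
next
  assume R: "\<forall>i. \<exists>\<tau> \<epsilon>. lattice_iso M M \<tau> \<epsilon> \<and> \<tau> i = 1"
  show "linearly_edge_transitive M"
    unfolding linearly_edge_transitive_def LAut_def
  proof
    fix i
    obtain \<tau> \<epsilon> where iso: "lattice_iso M M \<tau> \<epsilon>" and i: "\<tau> i = 1" using R by blast
    then have "inj \<tau>" and \<epsilon>: "\<epsilon> i = 1 \<or> \<epsilon> i = -1" by (auto simp: lattice_iso_def bij_is_inj)
    then have "signed_perm \<tau> \<epsilon> ` residue_class M (axis 1 1) = residue_class M (axis i (\<epsilon> i))"
      using signed_perm_axis[of \<tau> \<epsilon> i 1] i by (simp add: signed_perm_image_residue_class[OF iso])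
    then show "\<exists>f\<in>linear_isos M M. f (residue_class M (axis 1 1)) \<in>
        {residue_class M (axis i 1), residue_class M (axis i (-1))}"
      using \<epsilon> by (intro bexI[OF _ linear_iso_of_lattice_iso[OF iso]]) auto
  qed
qed

section \<open>Cyclically invariant sublattices of \<open>\<int>\<^sup>3\<close>\<close>

text \<open>Sublattices of \<open>\<int>\<^sup>3\<close> are given by ternary predicates. A vector of coordinate sum zero is
  written \<open>(x, y, - x - y)\<close>; on these the cyclic shift acts as multiplication by a primitive third
  root of unity, and \<open>eisenstein_norm\<close> is the norm form.\<close>

definition eisenstein_norm :: "int \<Rightarrow> int \<Rightarrow> int" where
  "eisenstein_norm x y = x * x + x * y + y * y"

lemma eisenstein_norm_eq: "4 * eisenstein_norm x y = (2 * x + y)\<^sup>2 + 3 * y\<^sup>2"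
  by (simp add: eisenstein_norm_def power2_eq_square algebra_simps)

lemma eisenstein_norm_nonneg: "eisenstein_norm x y \<ge> 0"
  using eisenstein_norm_eq[of x y] zero_le_power2[of "2 * x + y"] zero_le_power2[of y] by linarith

lemma eisenstein_norm_eq_0_iff: "eisenstein_norm x y = 0 \<longleftrightarrow> x = 0 \<and> y = 0"
proof
  assume "eisenstein_norm x y = 0"
  then have "y\<^sup>2 = 0" "(2 * x + y)\<^sup>2 = 0"
    using eisenstein_norm_eq[of x y] zero_le_power2[of "2 * x + y"] zero_le_power2[of y]
    by linarith+
  then show "x = 0 \<and> y = 0" by auto
qed (simp add: eisenstein_norm_def)

section \<open>Division with remainder in \<int>[\<omega>]\<close>

lemma nearest_quotient:
  fixes A N :: int
  assumes "N > 0"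
  obtains p where "2 * \<bar>A - N * p\<bar> \<le> N"
proof
  \<comment> \<open>This is the floor of A/N + 1/2, the rounding of A/N to a nearest
    integer.\<close>
  define p where "p = (2 * A + N) div (2 * N)"
  have "2 * N * p + (2 * A + N) mod (2 * N) = 2 * A + N"
    unfolding p_def by (rule mult_div_mod_eq)
  moreover have "0 \<le> (2 * A + N) mod (2 * N)" "(2 * A + N) mod (2 * N) < 2 * N"
    using assms by simp_all
  ultimately show "2 * \<bar>A - N * p\<bar> \<le> N" by (auto simp: abs_if algebra_simps)
qed

text \<open>Multiplication by \<omega> sends (x, y, -x-y) to (y, -x-y, x), so what is subtracted
  from (s, t) is p + q \<omega> times the vector of \<open>x\<close> and \<open>y\<close>. Rounding
  both coordinates of the exact quotient makes the norm of the remainder at most 3/4 of the norm of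
  the divisor.\<close>

lemma eisenstein_division:
  assumes "eisenstein_norm x y > 0"
  obtains p q where
    "eisenstein_norm (s - (p * x + q * y)) (t - (p * y - q * (x + y))) < eisenstein_norm x y"
proof -
  let ?N = "eisenstein_norm x y"
  \<comment> \<open>By Cramer's rule the exact quotient is A/N + (B/N) \<omega>, where N is the norm
    of the divisor.\<close>
  define A B where "A = s * (x + y) + t * y" and "B = s * y - t * x"
  obtain p where p: "2 * \<bar>A - ?N * p\<bar> \<le> ?N" using assms by (rule nearest_quotient)
  obtain q where q: "2 * \<bar>B - ?N * q\<bar> \<le> ?N" using assms by (rule nearest_quotient)
  let ?R = "eisenstein_norm (s - (p * x + q * y)) (t - (p * y - q * (x + y)))"
  define a b where "a = A - ?N * p" and "b = B - ?N * q"
  \<comment> \<open>The right side is the norm of a + b \<omega>, and the remainder is (a + b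
    \<omega>)/N times the divisor.\<close>
  have NR: "?N * ?R = a * a - a * b + b * b"
    unfolding eisenstein_norm_def A_def B_def a_def b_def by algebra
  have "\<bar>2 * a\<bar> \<le> ?N" "\<bar>2 * b\<bar> \<le> ?N" using p q unfolding a_def b_def abs_mult by simp_all
  then have "\<bar>2 * a\<bar> * \<bar>2 * a\<bar> \<le> ?N * ?N" "\<bar>2 * b\<bar> * \<bar>2 * b\<bar> \<le> ?N * ?N"
    "\<bar>2 * a\<bar> * \<bar>2 * b\<bar> \<le> ?N * ?N"
    using assms by (intro mult_mono; simp)+
  then have "4 * (a * a) \<le> ?N * ?N" "4 * (b * b) \<le> ?N * ?N" "\<bar>4 * (a * b)\<bar> \<le> ?N * ?N"
    by (simp_all add: abs_mult[symmetric])
  then have "4 * (?N * ?R) \<le> 3 * (?N * ?N)"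
    unfolding NR by (simp add: algebra_simps abs_le_iff)
  moreover have "?N * ?N > 0" using assms by simp
  ultimately have "?N * ?R < ?N * ?N" by linarith
  then have "?R < ?N" using assms by (simp add: mult_less_cancel_left_pos)
  then show ?thesis by (rule that)
qed

lemma subgroup_generator:
  fixes S :: "int \<Rightarrow> bool"
  assumes diff: "\<And>x y. S x \<Longrightarrow> S y \<Longrightarrow> S (x - y)" and nz: "S n" "n \<noteq> 0"
  obtains d where "d > 0" "\<And>x. S x \<longleftrightarrow> d dvd x"
proof -
  have zero: "S 0" using diff[OF nz(1) nz(1)] by simp
  have neg: "S (- x)" if "S x" for x using diff[OF zero that] by simp
  define d where "d = (LEAST m. m > 0 \<and> S (int m))"
  have "nat \<bar>n\<bar> > 0 \<and> S (int (nat \<bar>n\<bar>))" using nz neg by (auto simp: abs_if)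
  then have d: "d > 0 \<and> S (int d)" unfolding d_def by (rule LeastI)
  have mult: "S (k * int d)" for k
  proof (induction k rule: int_induct[where k = 0])
    case (step1 k)
    then show ?case using diff[of "k * int d" "- int d"] neg d by (simp add: algebra_simps)
  next
    case (step2 k)
    then show ?case using diff[of "k * int d" "int d"] d by (simp add: algebra_simps)
  qed (simp add: zero)
  have "int d dvd x" if "S x" for x
  proof -
    have "S (x mod int d)"
      using diff[OF that mult[of "x div int d"]] by (simp add: minus_div_mult_eq_mod)
    moreover have "x mod int d \<ge> 0" "x mod int d < int d" using d by simp_all
    ultimately have "\<not> x mod int d > 0"
      using not_less_Least[of "nat (x mod int d)" "\<lambda>m. m > 0 \<and> S (int m)"] unfolding d_def[symmetric]
      by auto
    with \<open>x mod int d \<ge> 0\<close> show ?thesis by (simp add: dvd_eq_mod_eq_0)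
  qed
  then have "S x \<longleftrightarrow> int d dvd x" for x
    using mult by (metis dvdE mult.commute)
  with d show ?thesis by (intro that[of "int d"]) auto
qed

section \<open>Full-rank lattices invariant under the shift\<close>

text \<open>Full rank can be stated on the first axis alone, since the shift carries the multiple
  found there to the other axes.\<close>

locale cyclic_lattice =
  fixes L :: "int \<Rightarrow> int \<Rightarrow> int \<Rightarrow> bool"
  assumes diff: "L x y z \<Longrightarrow> L x' y' z' \<Longrightarrow> L (x - x') (y - y') (z - z')"
    and shift: "L x y z \<Longrightarrow> L y z x"
    and full_rank: "\<exists>n. n \<noteq> 0 \<and> L n 0 0"
begin

lemma zero: "L 0 0 0"
  using full_rank diff by fastforce

lemma uminus: "L x y z \<Longrightarrow> L (- x) (- y) (- z)"
  using diff[OF zero] by fastforce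

lemma add: "L x y z \<Longrightarrow> L x' y' z' \<Longrightarrow> L (x + x') (y + y') (z + z')"
  using diff[of x y z "- x'" "- y'" "- z'"] uminus by fastforce

lemma scale: "L x y z \<Longrightarrow> L (k * x) (k * y) (k * z)"
proof (induction k rule: int_induct[where k = 0])
  case base
  then show ?case by (simp add: zero)
next
  case (step1 k)
  then show ?case using add[of "k * x" "k * y" "k * z" x y z] by (simp add: algebra_simps)
next
  case (step2 k)
  then show ?case using diff[of "k * x" "k * y" "k * z" x y z] by (simp add: algebra_simps)
qed

text \<open>A vector of least positive norm generates: division by it leaves a remainder of smaller
  norm in the lattice, which must be zero.\<close>

lemma sum_zero_generator:
  obtains x y where "L x y (- x - y)" "eisenstein_norm x y > 0"
    "\<And>s t. L s t (- s - t) \<Longrightarrow> \<exists>p q. s = p * x + q * y \<and> t = p * y - q * (x + y)"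
proof -
  define P where "P n \<longleftrightarrow> (\<exists>x y. L x y (- x - y) \<and> eisenstein_norm x y > 0 \<and> n = nat (eisenstein_norm x y))"
    for n
  obtain n where n: "n \<noteq> 0" "L n 0 0" using full_rank by blast
  have "L n 0 (- n)" using diff[OF n(2) shift[OF n(2)]] by simp
  then have "P (nat (eisenstein_norm n 0))"
    using n(1) eisenstein_norm_nonneg[of n 0] eisenstein_norm_eq_0_iff[of n 0]
    unfolding P_def by (intro exI[of _ n] exI[of _ 0]) auto
  then have "P (LEAST m. P m)" by (rule LeastI)
  then obtain x y where xy: "L x y (- x - y)" "eisenstein_norm x y > 0"
    and least: "(LEAST m. P m) = nat (eisenstein_norm x y)" unfolding P_def by blast
  show ?thesis
  proof (rule that[OF xy])
    fix s t assume st: "L s t (- s - t)"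
    obtain p q where pq: "eisenstein_norm (s - (p * x + q * y)) (t - (p * y - q * (x + y)))
        < eisenstein_norm x y" (is "eisenstein_norm ?s ?t < _")
      using eisenstein_division[OF xy(2)] .
    have "L ?s ?t (- ?s - ?t)"
      using diff[OF st add[OF scale[OF xy(1), of p] scale[OF shift[OF xy(1)], of q]]]
      by (simp add: algebra_simps)
    moreover have "\<not> P (nat (eisenstein_norm ?s ?t))"
      using not_less_Least[of "nat (eisenstein_norm ?s ?t)" P] pq xy(2) least by auto
    ultimately have "eisenstein_norm ?s ?t = 0"
      using eisenstein_norm_nonneg[of ?s ?t] unfolding P_def by force
    then show "\<exists>p q. s = p * x + q * y \<and> t = p * y - q * (x + y)"
      unfolding eisenstein_norm_eq_0_iff by (intro exI[of _ p] exI[of _ q]) simp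
  qed
qed

text \<open>The index of (invariant vectors) \<open>\<oplus>\<close> (vectors of sum zero) in \<open>L\<close> is 1 or 3. If it is 1,
  \<open>L\<close> is of the second type. If it is 3, pick \<open>u\<close> whose sum generates all sums and let
  \<open>\<pi> v\<close> be the difference of \<open>u\<close> and its shift, where \<open>v\<close> generates the sum-zero part over
  \<open>\<int>[\<omega>]\<close>. Then \<open>\<pi>\<close> is prime to \<open>1 - \<omega>\<close>, so it becomes \<open>\<plusminus>1\<close> after changing
  \<open>u\<close> by a vector of sum zero, and then \<open>u\<close> and its shifts generate \<open>L\<close>.\<close>
lemma classification:
  shows "\<exists>a b c. (\<forall>x y z. L x y z \<longleftrightarrow>
      (\<exists>p q r. x = a * p + c * q + b * r \<and> y = b * p + a * q + c * r \<and> z = c * p + b * q + a * r)) \<or>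
    (\<forall>x y z. L x y z \<longleftrightarrow>
      (\<exists>p q r. x = a * p + b * q + c * r \<and> y = a * p + c * q + (- b - c) * r \<and>
         z = a * p + (- b - c) * q + b * r))"
proof -
  obtain x0 y0 where v: "L x0 y0 (- x0 - y0)" "eisenstein_norm x0 y0 > 0"
    and gen: "\<And>s t. L s t (- s - t) \<Longrightarrow> \<exists>p q. s = p * x0 + q * y0 \<and> t = p * y0 - q * (x0 + y0)"
    by (rule sum_zero_generator) blast
  have inv_sum: "L (x + y + z) (x + y + z) (x + y + z)" if "L x y z" for x y z
    using add[OF add[OF that shift[OF that]] shift[OF shift[OF that]]] by (simp add: algebra_simps)
  obtain n where n: "n \<noteq> 0" "L n 0 0" using full_rank by blast
  obtain a where a: "a > 0" "\<And>x. L x x x \<longleftrightarrow> a dvd x"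
    by (rule subgroup_generator[of "\<lambda>x. L x x x" n])
       (use diff n inv_sum[OF n(2)] in auto)
  obtain d where d: "d > 0" "\<And>s. (\<exists>x y z. L x y z \<and> s = x + y + z) \<longleftrightarrow> d dvd s"
  proof (rule subgroup_generator[of "\<lambda>s. \<exists>x y z. L x y z \<and> s = x + y + z" n])
    fix s t assume "\<exists>x y z. L x y z \<and> s = x + y + z" "\<exists>x y z. L x y z \<and> t = x + y + z"
    then obtain x y z x' y' z' where "L x y z" "s = x + y + z" "L x' y' z'" "t = x' + y' + z'"
      by blast
    then show "\<exists>x y z. L x y z \<and> s - t = x + y + z"
      using diff by (intro exI[of _ "x - x'"] exI[of _ "y - y'"] exI[of _ "z - z'"]) auto
  next
    show "\<exists>x y z. L x y z \<and> n = x + y + z"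
      using n(2) by (intro exI[of _ n] exI[of _ 0]) simp
  qed (use n in auto)
  have "L a a a" using a(2) by simp
  then have "d dvd a + a + a" using d(2) by blast
  then have d3a: "d dvd 3 * a" by (simp add: algebra_simps)
  obtain u1 u2 u3 where u: "L u1 u2 u3" "d = u1 + u2 + u3" using d(2)[of d] by auto
  have "a dvd d" using inv_sum[OF u(1)] a(2) u(2) by simp
  then obtain k where k: "d = a * k" by auto
  have "k dvd 3" using d3a a(1) by (auto simp: k mult.commute)
  moreover have "k > 0" using d(1) a(1) k by (simp add: zero_less_mult_iff)
  \<comment> \<open>The coordinate sum has the sum-zero part as kernel and maps (a, a, a) to 3a,
    while all sums are the multiples of d = a k. So the index of the direct sum in \<open>L\<close>
    is 3/k, and \<open>k = 3\<close> is the split case.\<close>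
  ultimately have "k = 1 \<or> k = 3"
  proof -
    have "k \<le> 3" using \<open>k dvd 3\<close> by (simp add: zdvd_imp_le)
    moreover have "\<not> (2::int) dvd 3" by simp
    ultimately show ?thesis using \<open>k > 0\<close> \<open>k dvd 3\<close> by (cases "k = 2") auto
  qed
  then show ?thesis
  proof
    assume "k = 3"
    have "L x y z \<longleftrightarrow> (\<exists>p q r. x = a * p + x0 * q + y0 * r \<and> y = a * p + y0 * q + (- x0 - y0) * r \<and>
         z = a * p + (- x0 - y0) * q + x0 * r)" for x y z
    proof
      assume L: "L x y z"
      then have "d dvd x + y + z" using d(2) by blast
      then obtain p where "x + y + z = d * p" by (rule dvdE)
      then have p: "x + y + z = 3 * a * p" using k \<open>k = 3\<close> by simp
      have "L (a * p) (a * p) (a * p)" using a(2) by simp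
      moreover have "z - a * p = - (x - a * p) - (y - a * p)" using p by simp
      ultimately have "L (x - a * p) (y - a * p) (- (x - a * p) - (y - a * p))"
        using diff[OF L] by metis
      from gen[OF this] obtain q r where "x - a * p = q * x0 + r * y0" "y - a * p = q * y0 - r * (x0 + y0)"
        by blast
      then show "\<exists>p q r. x = a * p + x0 * q + y0 * r \<and> y = a * p + y0 * q + (- x0 - y0) * r \<and>
         z = a * p + (- x0 - y0) * q + x0 * r"
        using p by (intro exI[of _ p] exI[of _ q] exI[of _ r]) (simp add: algebra_simps)
    next
      assume "\<exists>p q r. x = a * p + x0 * q + y0 * r \<and> y = a * p + y0 * q + (- x0 - y0) * r \<and>
         z = a * p + (- x0 - y0) * q + x0 * r"
      then obtain p q r where e: "x = a * p + x0 * q + y0 * r" "y = a * p + y0 * q + (- x0 - y0) * r"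
         "z = a * p + (- x0 - y0) * q + x0 * r" by blast
      have "L (a * p) (a * p) (a * p)" using a(2) by simp
      from add[OF add[OF this scale[OF v(1), of q]] scale[OF shift[OF v(1)], of r]]
      show "L x y z" unfolding e by (simp add: algebra_simps)
    qed
    then show ?thesis by blast
  next
    assume "k = 1"
    then have ad: "a = d" using k by simp
    have "L (u1 - u2) (u2 - u3) (- (u1 - u2) - (u2 - u3))"
      using diff[OF u(1) shift[OF u(1)]] by simp
    from gen[OF this] obtain p q
      where pq: "u1 - u2 = p * x0 + q * y0" "u2 - u3 = p * y0 - q * (x0 + y0)" by blast
    \<comment> \<open>Divisibility by 3 means that 1 - \<omega> divides p + q \<omega>. Then
      \<open>u\<close> could be changed into an invariant vector of sum d = a, but the sum of an
      invariant vector in \<open>L\<close> is a multiple of 3a.\<close>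
    have n3: "\<not> 3 dvd p + q"
    proof
      assume "3 dvd p + q"
      then obtain m where m: "p = 3 * m - q" by (auto simp: algebra_simps dvd_def)
      \<comment> \<open>\<open>p + q \<omega> = (1 - \<omega>) (2 m - q + m \<omega>)\<close>, so \<open>u\<close> minus a sum-zero vector is invariant.\<close>
      define w1 w2 where "w1 = (2 * m - q) * x0 + m * y0" and "w2 = (2 * m - q) * y0 - m * (x0 + y0)"
      have "L w1 w2 (- w1 - w2)"
        using add[OF scale[OF v(1), of "2 * m - q"] scale[OF shift[OF v(1)], of m]]
        by (simp add: w1_def w2_def algebra_simps)
      from diff[OF u(1) this] have "L (u1 - w1) (u2 - w2) (u3 - (- w1 - w2))" .
      moreover have "u1 - w1 = u2 - w2" "u2 - w2 = u3 - (- w1 - w2)"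
        using pq by (simp_all add: w1_def w2_def m algebra_simps)
      ultimately have "L (u1 - w1) (u1 - w1) (u1 - w1)" by metis
      then have "a dvd u1 - w1" using a(2) by simp
      then obtain l where l: "u1 - w1 = a * l" by (rule dvdE)
      have "a = 3 * (u1 - w1)"
        using u(2) ad \<open>u1 - w1 = u2 - w2\<close> \<open>u2 - w2 = u3 - (- w1 - w2)\<close> by simp
      then have "a * 1 = a * (3 * l)" unfolding l by simp
      then have "1 = 3 * l" using a(1) mult_left_cancel[of a 1 "3 * l"] by simp
      then show False by presburger
    qed
    obtain e m where em: "p + q = e + 3 * m" "e * e = (1::int)"
    proof -
      have "(p + q) mod 3 = 1 \<or> (p + q) mod 3 = 2" using n3 by presburger
      then show ?thesis
      proof
        assume "(p + q) mod 3 = 1"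
        then have "p + q = 1 + 3 * ((p + q) div 3)" by presburger
        then show ?thesis by (rule that) simp
      next
        assume "(p + q) mod 3 = 2"
        then have "p + q = -1 + 3 * ((p + q) div 3 + 1)" by presburger
        then show ?thesis by (rule that) simp
      qed
    qed
    \<comment> \<open>The solution of p + q \<omega> = e + (1 - \<omega>)(i + j \<omega>).
      Subtracting i + j \<omega> times the generator of the sum-zero part from \<open>u\<close>
      leaves a vector whose difference from its shift is \<open>e\<close> times that
      generator.\<close>
    define i j where "i = m + m - q" and "j = m"
    define w1 w2 where "w1 = i * x0 + j * y0" and "w2 = i * y0 - j * (x0 + y0)"
    have w: "L w1 w2 (- w1 - w2)"
      using add[OF scale[OF v(1), of i] scale[OF shift[OF v(1)], of j]]
      by (simp add: w1_def w2_def algebra_simps)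
    define b1 b2 b3 where "b1 = u1 - w1" and "b2 = u2 - w2" and "b3 = u3 - (- w1 - w2)"
    have b: "L b1 b2 b3" using diff[OF u(1) w] by (simp add: b1_def b2_def b3_def)
    have p: "p = e + 3 * m - q" using em(1) by simp
    have b12: "b1 - b2 = e * x0" "b2 - b3 = e * y0"
      using pq by (simp_all add: b1_def b2_def b3_def w1_def w2_def i_def j_def p algebra_simps)
    have x0: "x0 = e * (b1 - b2)" and y0: "y0 = e * (b2 - b3)"
      using em(2) by (simp_all add: b12 flip: mult.assoc)
    have sum: "b1 + b2 + b3 = d" using u(2) by (simp add: b1_def b2_def b3_def)
    have "L x y z \<longleftrightarrow> (\<exists>p q r. x = b1 * p + b3 * q + b2 * r \<and> y = b2 * p + b1 * q + b3 * r \<and>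
        z = b3 * p + b2 * q + b1 * r)" for x y z
    proof
      assume L: "L x y z"
      then have "d dvd x + y + z" using d(2) by blast
      then obtain l where l: "x + y + z = d * l" by auto
      have "L (x - l * b1) (y - l * b2) (- (x - l * b1) - (y - l * b2))"
      proof -
        have "z - l * b3 = - (x - l * b1) - (y - l * b2)"
          using l by (simp add: algebra_simps flip: sum)
        then show ?thesis using diff[OF L scale[OF b, of l]] by metis
      qed
      from gen[OF this] obtain q r
        where "x - l * b1 = q * x0 + r * y0" "y - l * b2 = q * y0 - r * (x0 + y0)" by blast
      \<comment> \<open>With S the shift and \<open>b\<close> the vector (b1, b2, b3), the generator
        is e (1 - S) b, and (q + r S)(1 - S) = q + (r - q) S - r S^2. The columns of the matrix are
        b, S^2 b and S b in this order.\<close>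
      then have "x = b1 * (l + e * q) + b3 * (- e * r) + b2 * (e * r - e * q)"
        "y = b2 * (l + e * q) + b1 * (- e * r) + b3 * (e * r - e * q)"
        unfolding x0 y0 by (simp_all add: algebra_simps)
      moreover have "z = d * l - x - y" using l by simp
      ultimately show "\<exists>p q r. x = b1 * p + b3 * q + b2 * r \<and> y = b2 * p + b1 * q + b3 * r \<and>
        z = b3 * p + b2 * q + b1 * r"
        by (intro exI[of _ "l + e * q"] exI[of _ "- e * r"] exI[of _ "e * r - e * q"])
           (simp add: algebra_simps flip: sum)
    next
      assume "\<exists>p q r. x = b1 * p + b3 * q + b2 * r \<and> y = b2 * p + b1 * q + b3 * r \<and>
        z = b3 * p + b2 * q + b1 * r"
      then obtain p q r where e: "x = b1 * p + b3 * q + b2 * r" "y = b2 * p + b1 * q + b3 * r"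
        "z = b3 * p + b2 * q + b1 * r" by blast
      from add[OF add[OF scale[OF b, of p] scale[OF shift[OF shift[OF b]], of q]] scale[OF shift[OF b], of r]]
      show "L x y z" unfolding e by (simp add: algebra_simps)
    qed
    then show ?thesis by blast
  qed
qed

end

section \<open>Edge-transitivity in dimension three\<close>

text \<open>Reads nonsingularity off the lattice alone: preimages of the vectors n e_i form an
  integer matrix X with M X equal to n times the identity.\<close>

lemma det_nonzero_of_full_rank:
  fixes M :: "int ^ 'n ^ 'n"
  assumes "n \<noteq> 0" "\<And>i. axis i n \<in> column_lattice M"
  shows "det M \<noteq> 0"
proof -
  have "\<exists>X. \<forall>i. axis i n = M *v X i"
    using assms(2) by (intro choice allI) (auto simp: column_lattice_def)
  then obtain X where X: "\<And>i. M *v X i = axis i n" by metis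
  have "M ** (\<chi> j i. X i $ j) = mat n"
  proof -
    have "(M ** (\<chi> j i. X i $ j)) $ k $ i = (M *v X i) $ k" for k i
      by (simp add: matrix_matrix_mult_def matrix_vector_mult_def)
    then show ?thesis by (simp add: vec_eq_iff mat_def X axis_def)
  qed
  moreover have "det (mat n :: int ^ 'n ^ 'n) = n ^ CARD('n)"
    by (subst det_diagonal) (simp_all add: mat_def)
  ultimately have "det M * det (\<chi> j i. X i $ j) = n ^ CARD('n)" by (metis det_mul)
  with assms(1) show ?thesis by auto
qed

text \<open>The witness is the first column of the adjugate of \<open>M\<close>.\<close>

lemma axis_1_det_in_column_lattice:
  fixes M :: "int ^ 3 ^ 3"
  shows "axis 1 (det M) \<in> column_lattice M"
proof -
  have "axis 1 (det M) = M *v vector [M$2$2 * M$3$3 - M$2$3 * M$3$2,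
     M$2$3 * M$3$1 - M$2$1 * M$3$3, M$2$1 * M$3$2 - M$2$2 * M$3$1]"
    by (simp add: vec_eq_iff forall_3 matrix_vector_mult_def sum_3 axis_def det_3)
       (simp add: algebra_simps)
  then show ?thesis unfolding column_lattice_def by (rule range_eqI)
qed

lemma vector_3_eq_iff: "vector [x, y, z] = (v :: 'a::zero ^ 3) \<longleftrightarrow> x = v $ 1 \<and> y = v $ 2 \<and> z = v $ 3"
  by (simp add: vec_eq_iff forall_3)

lemma exists_vector_3: "(\<exists>v :: 'a::zero ^ 3. P v) \<longleftrightarrow> (\<exists>x y z. P (vector [x, y, z]))"
  using forall_vector_3[of "\<lambda>v. \<not> P v"] by auto

lemma mem_column_lattice_3:
  fixes M :: "int ^ 3 ^ 3"
  shows "vector [x, y, z] \<in> column_lattice M \<longleftrightarrow> (\<exists>p q r.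
    x = M$1$1 * p + M$1$2 * q + M$1$3 * r \<and>
    y = M$2$1 * p + M$2$2 * q + M$2$3 * r \<and>
    z = M$3$1 * p + M$3$2 * q + M$3$3 * r)"
  unfolding column_lattice_def image_iff bex_UNIV exists_vector_3
  by (simp add: vector_3_eq_iff matrix_vector_mult_def sum_3)

lemma mem_column_lattice_M1:
  "vector [x, y, z] \<in> column_lattice (mat_M1 a b c) \<longleftrightarrow> (\<exists>p q r.
    x = a * p + c * q + b * r \<and> y = b * p + a * q + c * r \<and> z = c * p + b * q + a * r)"
  by (simp add: mem_column_lattice_3 mat_M1_def)

lemma mem_column_lattice_M1':
  "vector [x, y, z] \<in> column_lattice (mat_M1' a b c) \<longleftrightarrow> (\<exists>p q r.
    x = a * p + b * q + c * r \<and> y = a * p + c * q + (- b - c) * r \<and>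
    z = a * p + (- b - c) * q + b * r)"
  by (simp add: mem_column_lattice_3 mat_M1'_def)

section \<open>From edge-transitivity to a shift-invariant lattice\<close>

text \<open>Some member is the required 3-cycle or its inverse, whose square is the required one;
  otherwise the transpositions (1 2) and (1 3) are members, and one of their products is the
  cycle.\<close>

lemma three_cycle:
  fixes S :: "(3 \<Rightarrow> 3) set"
  assumes bij: "\<And>\<tau>. \<tau> \<in> S \<Longrightarrow> bij \<tau>"
    and comp: "\<And>\<sigma> \<tau>. \<sigma> \<in> S \<Longrightarrow> \<tau> \<in> S \<Longrightarrow> \<sigma> \<circ> \<tau> \<in> S"
    and trans: "\<And>i. \<exists>\<tau>\<in>S. \<tau> i = 1"
  shows "\<exists>\<tau>\<in>S. \<tau> 1 = 2 \<and> \<tau> 2 = 3 \<and> \<tau> 3 = 1"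
proof -
  obtain \<sigma> \<tau> where \<sigma>: "\<sigma> \<in> S" "\<sigma> 2 = 1" and \<tau>: "\<tau> \<in> S" "\<tau> 3 = 1" using trans by meson
  have inj: "\<rho> i = \<rho> j \<longleftrightarrow> i = j" if "\<rho> \<in> S" for \<rho> i j
    using bij[OF that] by (simp add: bij_is_inj inj_eq)
  have s: "\<sigma> 1 = 2 \<and> \<sigma> 3 = 3 \<or> \<sigma> 1 = 3 \<and> \<sigma> 3 = 2"
    using exhaust_3[of "\<sigma> 1"] exhaust_3[of "\<sigma> 3"]
      inj[OF \<sigma>(1), of 1 2] inj[OF \<sigma>(1), of 3 2] inj[OF \<sigma>(1), of 1 3] \<sigma>(2) by auto
  have t: "\<tau> 1 = 2 \<and> \<tau> 2 = 3 \<or> \<tau> 1 = 3 \<and> \<tau> 2 = 2"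
    using exhaust_3[of "\<tau> 1"] exhaust_3[of "\<tau> 2"]
      inj[OF \<tau>(1), of 1 3] inj[OF \<tau>(1), of 2 3] inj[OF \<tau>(1), of 1 2] \<tau>(2) by auto
  consider "\<tau> 1 = 2 \<and> \<tau> 2 = 3" | "\<sigma> 1 = 3 \<and> \<sigma> 3 = 2" | "\<sigma> 1 = 2 \<and> \<sigma> 3 = 3" "\<tau> 1 = 3 \<and> \<tau> 2 = 2"
    using s t by blast
  then show ?thesis
  proof cases
    case 1
    then show ?thesis using \<tau> by blast
  next
    case 2
    then show ?thesis using \<sigma> comp[of \<sigma> \<sigma>] by (intro bexI[of _ "\<sigma> \<circ> \<sigma>"]) auto
  next
    case 3
    then show ?thesis using \<sigma> \<tau> comp[of \<tau> \<sigma>] by (intro bexI[of _ "\<tau> \<circ> \<sigma>"]) auto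
  qed
qed

lemma lattice_iso_uminus:
  assumes "lattice_iso M M' \<tau> \<epsilon>"
  shows "lattice_iso M M' \<tau> (\<lambda>j. - \<epsilon> j)"
proof -
  have "signed_perm \<tau> (\<lambda>j. - \<epsilon> j) x = - signed_perm \<tau> \<epsilon> x" for x
    by (simp add: signed_perm_def vec_eq_iff)
  with assms show ?thesis by (auto simp: lattice_iso_def column_lattice_uminus_iff)
qed

text \<open>The cube of a signed 3-cycle is the product of its signs times the identity. Only for
  product 1 can sign changes of coordinates turn it into the plain shift; negating all three signs
  corrects the product -1.\<close>

lemma linearly_edge_transitive_imp_signed_cycle:
  fixes M :: "int ^ 3 ^ 3"
  assumes "linearly_edge_transitive M"
  obtains \<tau> \<epsilon> where "lattice_iso M M \<tau> \<epsilon>" "\<tau> 1 = 2" "\<tau> 2 = 3" "\<tau> 3 = 1" "\<epsilon> 1 * \<epsilon> 2 * \<epsilon> 3 = 1"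
proof -
  have "\<exists>\<tau>\<in>{\<tau>. \<exists>\<epsilon>. lattice_iso M M \<tau> \<epsilon>}. \<tau> 1 = 2 \<and> \<tau> 2 = 3 \<and> \<tau> 3 = 1"
  proof (rule three_cycle)
    show "\<exists>\<tau>\<in>{\<tau>. \<exists>\<epsilon>. lattice_iso M M \<tau> \<epsilon>}. \<tau> i = 1" for i
      using assms unfolding linearly_edge_transitive_iff by blast
    show "bij \<tau>" if "\<tau> \<in> {\<tau>. \<exists>\<epsilon>. lattice_iso M M \<tau> \<epsilon>}" for \<tau>
      using that unfolding lattice_iso_def by blast
    show "\<sigma> \<circ> \<tau> \<in> {\<tau>. \<exists>\<epsilon>. lattice_iso M M \<tau> \<epsilon>}"
      if "\<sigma> \<in> {\<tau>. \<exists>\<epsilon>. lattice_iso M M \<tau> \<epsilon>}" "\<tau> \<in> {\<tau>. \<exists>\<epsilon>. lattice_iso M M \<tau> \<epsilon>}" for \<sigma> \<tau>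
      using that lattice_iso_trans by blast
  qed
  then obtain \<tau> \<epsilon> where \<tau>: "lattice_iso M M \<tau> \<epsilon>" "\<tau> 1 = 2" "\<tau> 2 = 3" "\<tau> 3 = 1" by blast
  have "\<epsilon> j = 1 \<or> \<epsilon> j = -1" for j using \<tau>(1) unfolding lattice_iso_def by blast
  from this[of 1] this[of 2] this[of 3]
  have "\<epsilon> 1 * \<epsilon> 2 * \<epsilon> 3 = 1 \<or> (- \<epsilon> 1) * (- \<epsilon> 2) * (- \<epsilon> 3) = 1"
    by (elim disjE) simp_all
  then show ?thesis using that[OF \<tau>] that[OF lattice_iso_uminus[OF \<tau>(1)] \<tau>(2-4)] by blast
qed

lemma linearly_edge_transitive_imp_cayley_isomorphic:
  fixes M :: "int ^ 3 ^ 3"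
  assumes "det M \<noteq> 0" and "linearly_edge_transitive M"
  shows "\<exists>a b c. \<exists>M' \<in> {mat_M1 a b c, mat_M1' a b c}. det M' \<noteq> 0 \<and> cayley_isomorphic M M'"
proof -
  obtain \<tau> \<epsilon> where iso: "lattice_iso M M \<tau> \<epsilon>"
    and \<tau>: "\<tau> 1 = 2" "\<tau> 2 = 3" "\<tau> 3 = 1" and prod: "\<epsilon> 1 * \<epsilon> 2 * \<epsilon> 3 = 1"
    by (rule linearly_edge_transitive_imp_signed_cycle[OF assms(2)])
  have \<epsilon>: "\<epsilon> j \<in> {1, -1}" for j using iso unfolding lattice_iso_def by blast
  have sq: "\<epsilon> j * (\<epsilon> j * x) = x" for j x using \<epsilon>[of j] by auto
  have \<epsilon>3: "\<epsilon> 3 = \<epsilon> 1 * \<epsilon> 2" using prod sq by (metis mult.assoc mult.commute mult_1_right)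
  \<comment> \<open>Conjugation by the diagonal matrix of \<open>\<delta>\<close> turns the signed cycle into the cyclic shift.\<close>
  define \<delta> :: "3 \<Rightarrow> int" where "\<delta> j = (if j = 1 then 1 else if j = 2 then \<epsilon> 1 else \<epsilon> 1 * \<epsilon> 2)" for j
  have \<delta>: "signed_perm id \<delta> (vector [x, y, z]) = vector [x, \<epsilon> 1 * y, \<epsilon> 1 * (\<epsilon> 2 * z)]" for x y z
    by (simp add: signed_perm_def \<delta>_def vec_eq_iff forall_3)
  define L where "L x y z \<longleftrightarrow> signed_perm id \<delta> (vector [x, y, z]) \<in> column_lattice M" for x y z
  have n: "L (det M) 0 0"
  proof -
    have "signed_perm id \<delta> (vector [det M, 0, 0]) = axis 1 (det M)"
      unfolding \<delta> by (simp add: vector_3_eq_iff axis_def)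
    then show ?thesis using axis_1_det_in_column_lattice[of M] by (simp add: L_def)
  qed
  interpret cyclic_lattice L
  proof
    fix x y z x' y' z'
    assume xyz: "L x y z"
    have "signed_perm \<tau> \<epsilon> (signed_perm id \<delta> (vector [x, y, z])) \<in> column_lattice M"
      using xyz iso by (simp add: L_def lattice_iso_def)
    moreover have "signed_perm \<tau> \<epsilon> (signed_perm id \<delta> (vector [x, y, z])) = signed_perm id \<delta> (vector [y, z, x])"
      unfolding \<delta> by (simp add: signed_perm_def vec_eq_iff forall_3 \<tau> \<epsilon>3 sq mult.left_commute mult.assoc)
    ultimately show "L y z x" by (simp add: L_def)
    assume x'y'z': "L x' y' z'"
    have "vector [x - x', y - y', z - z'] = (vector [x, y, z] - vector [x', y', z'] :: int ^ 3)"
      by (simp add: vector_3_eq_iff)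
    then show "L (x - x') (y - y') (z - z')"
      using column_lattice_diff xyz x'y'z' by (simp add: L_def signed_perm_diff)
  next
    show "\<exists>n. n \<noteq> 0 \<and> L n 0 0" using n assms(1) by blast
  qed
  obtain a b c M' where M': "M' \<in> {mat_M1 a b c, mat_M1' a b c}"
    and L: "\<And>x y z. L x y z \<longleftrightarrow> vector [x, y, z] \<in> column_lattice M'"
    using classification unfolding mem_column_lattice_M1[symmetric] mem_column_lattice_M1'[symmetric]
    by blast
  have "lattice_iso M' M id \<delta>"
  proof -
    have "signed_perm id \<delta> v \<in> column_lattice M \<longleftrightarrow> v \<in> column_lattice M'" for v
    proof -
      have "v = vector [v $ 1, v $ 2, v $ 3]" by (simp add: vec_eq_iff forall_3)
      then show ?thesis using L L_def by metis
    qed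
    moreover have "range \<delta> \<subseteq> {1, -1}"
      using \<epsilon>[of 1] \<epsilon>[of 2] by (auto simp: \<delta>_def)
    ultimately show ?thesis by (simp add: lattice_iso_def)
  qed
  then have "cayley_isomorphic M M'"
    unfolding cayley_isomorphic_iff using lattice_iso_sym by blast
  \<comment> \<open>The lattice of \<open>M'\<close> contains \<open>det M\<close> times each basis
    vector: the first is unaffected by the sign change, and the others are its shifts.\<close>
  moreover have "det M' \<noteq> 0"
  proof (rule det_nonzero_of_full_rank[OF assms(1)])
    fix i :: 3
    have "axis i (det M) = (vector [if i = 1 then det M else 0, if i = 2 then det M else 0,
        if i = 3 then det M else 0] :: int ^ 3)"
      by (simp add: vec_eq_iff forall_3 axis_def)
    moreover have "L (if i = 1 then det M else 0) (if i = 2 then det M else 0) (if i = 3 then det M else 0)"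
      using exhaust_3[of i] n shift[OF n] shift[OF shift[OF n]] by auto
    ultimately show "axis i (det M) \<in> column_lattice M'" unfolding L by simp
  qed
  ultimately show ?thesis using M' by blast
qed

section \<open>Edge-transitivity of the two families\<close>

text \<open>Arithmetic in the index type \<open>3\<close> is modulo 3, so the powers of the shift
  are the translations of the indices, and these act transitively.\<close>

lemma lattice_iso_add_of_shift:
  fixes M :: "int ^ 3 ^ 3"
  assumes shift: "\<And>x y z. vector [y, z, x] \<in> column_lattice M \<longleftrightarrow> vector [x, y, z] \<in> column_lattice M"
  shows "lattice_iso M M (\<lambda>i. i + k) (\<lambda>_. 1)"
proof -
  have bij: "bij (\<lambda>i. i + j)" for j :: 3
    by (intro bijI injI surjI[of _ "\<lambda>i. i - j"]) simp_all
  have one: "lattice_iso M M (\<lambda>i. i + 1) (\<lambda>_. 1)"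
  proof -
    have "signed_perm (\<lambda>i. i + 1) (\<lambda>_. 1) v \<in> column_lattice M \<longleftrightarrow> v \<in> column_lattice M" for v :: "int ^ 3"
    proof -
      have "v = vector [v $ 1, v $ 2, v $ 3]" by (simp add: vec_eq_iff forall_3)
      moreover have "signed_perm (\<lambda>i. i + 1) (\<lambda>_. 1) v = vector [v $ 2, v $ 3, v $ 1]"
      proof -
        have "(1::3) + 1 = 2" "(2::3) + 1 = 3" "(3::3) + 1 = 1" by simp_all
        then show ?thesis
          by (simp only: signed_perm_def vec_eq_iff forall_3 vec_lambda_beta vector_3 mult_1)
      qed
      ultimately show ?thesis using shift by metis
    qed
    then show ?thesis using bij by (simp add: lattice_iso_def image_subset_iff)
  qed
  have two: "lattice_iso M M (\<lambda>i. i + 2) (\<lambda>_. 1)"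
    using lattice_iso_trans[OF one one] by (simp add: o_def add.assoc)
  have three: "lattice_iso M M (\<lambda>i. i + 3) (\<lambda>_. 1)"
    using lattice_iso_trans[OF one two] by (simp add: o_def add.assoc)
  show ?thesis using exhaust_3[of k] one two three by metis
qed

text \<open>The shift permutes the three columns cyclically, and so do the witnesses with the
  coefficients.\<close>

lemma mat_M1_shift:
  "vector [y, z, x] \<in> column_lattice (mat_M1 a b c) \<longleftrightarrow> vector [x, y, z] \<in> column_lattice (mat_M1 a b c)"
  (is "?l \<longleftrightarrow> ?r")
proof
  assume ?l
  then obtain p q r where "y = a * p + c * q + b * r" "z = b * p + a * q + c * r"
    "x = c * p + b * q + a * r" unfolding mem_column_lattice_M1 by blast
  then show ?r unfolding mem_column_lattice_M1
    by (intro exI[of _ r] exI[of _ p] exI[of _ q]) simp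
next
  assume ?r
  then obtain p q r where "x = a * p + c * q + b * r" "y = b * p + a * q + c * r"
    "z = c * p + b * q + a * r" unfolding mem_column_lattice_M1 by blast
  then show ?l unfolding mem_column_lattice_M1
    by (intro exI[of _ q] exI[of _ r] exI[of _ p]) simp
qed

text \<open>The shift S fixes the first column. The other two are v and S v for a vector v of sum
  zero, so S^2 v = - v - S v, which gives the new coefficients.\<close>

lemma mat_M1'_shift:
  "vector [y, z, x] \<in> column_lattice (mat_M1' a b c) \<longleftrightarrow> vector [x, y, z] \<in> column_lattice (mat_M1' a b c)"
  (is "?l \<longleftrightarrow> ?r")
proof
  assume ?l
  then obtain p q r where "y = a * p + b * q + c * r" "z = a * p + c * q + (- b - c) * r"
    "x = a * p + (- b - c) * q + b * r" unfolding mem_column_lattice_M1' by blast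
  then show ?r unfolding mem_column_lattice_M1'
    by (intro exI[of _ p] exI[of _ "r - q"] exI[of _ "- q"]) (simp add: algebra_simps)
next
  assume ?r
  then obtain p q r where "x = a * p + b * q + c * r" "y = a * p + c * q + (- b - c) * r"
    "z = a * p + (- b - c) * q + b * r" unfolding mem_column_lattice_M1' by blast
  then show ?l unfolding mem_column_lattice_M1'
    by (intro exI[of _ p] exI[of _ "- r"] exI[of _ "q - r"]) (simp add: algebra_simps)
qed

lemma linearly_edge_transitive_of_shift:
  fixes M M' :: "int ^ 3 ^ 3"
  assumes shift: "\<And>x y z. vector [y, z, x] \<in> column_lattice M' \<longleftrightarrow> vector [x, y, z] \<in> column_lattice M'"
    and "cayley_isomorphic M M'"
  shows "linearly_edge_transitive M"
  unfolding linearly_edge_transitive_iff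
proof
  fix i
  obtain \<tau> \<epsilon> where iso: "lattice_iso M M' \<tau> \<epsilon>" using assms(2) cayley_isomorphic_iff by blast
  let ?\<tau>' = "inv_into UNIV \<tau>"
  have "surj \<tau>" using iso by (simp add: lattice_iso_def bij_is_surj)
  then have "\<tau> (?\<tau>' 1) = 1" by (rule surj_f_inv_f)
  \<comment> \<open>A translation of the indices for \<open>M'\<close> is conjugated back to
    \<open>M\<close>; it is the one that moves the index corresponding to \<open>i\<close> to the
    index corresponding to 1.\<close>
  then have "(\<tau> \<circ> (\<lambda>j. j + (?\<tau>' 1 - ?\<tau>' i)) \<circ> ?\<tau>') i = 1" by simp
  with lattice_iso_trans[OF lattice_iso_trans[OF iso lattice_iso_add_of_shift[OF shift]]
      lattice_iso_sym[OF iso]]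
  show "\<exists>\<tau> \<epsilon>. lattice_iso M M \<tau> \<epsilon> \<and> \<tau> i = 1" by blast
qed

theorem theorem29:
  fixes M :: "int ^ 3 ^ 3"
  assumes "det M \<noteq> 0"
  shows "linearly_edge_transitive M \<longleftrightarrow>
    (\<exists>a b c :: int.
       (det (mat_M1 a b c) \<noteq> 0 \<and> cayley_isomorphic M (mat_M1 a b c)) \<or>
       (det (mat_M1' a b c) \<noteq> 0 \<and> cayley_isomorphic M (mat_M1' a b c)))"
proof
  assume "linearly_edge_transitive M"
  from linearly_edge_transitive_imp_cayley_isomorphic[OF assms this]
  obtain a b c M' where "M' \<in> {mat_M1 a b c, mat_M1' a b c}" "det M' \<noteq> 0" "cayley_isomorphic M M'"
    by blast
  then show "\<exists>a b c. det (mat_M1 a b c) \<noteq> 0 \<and> cayley_isomorphic M (mat_M1 a b c) \<or>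
      det (mat_M1' a b c) \<noteq> 0 \<and> cayley_isomorphic M (mat_M1' a b c)"
    by (intro exI[of _ a] exI[of _ b] exI[of _ c]) auto
next
  assume "\<exists>a b c. det (mat_M1 a b c) \<noteq> 0 \<and> cayley_isomorphic M (mat_M1 a b c) \<or>
      det (mat_M1' a b c) \<noteq> 0 \<and> cayley_isomorphic M (mat_M1' a b c)"
  then obtain a b c where "cayley_isomorphic M (mat_M1 a b c) \<or> cayley_isomorphic M (mat_M1' a b c)"
    by blast
  then show "linearly_edge_transitive M"
  proof
    assume "cayley_isomorphic M (mat_M1 a b c)"
    with mat_M1_shift show ?thesis by (rule linearly_edge_transitive_of_shift)
  next
    assume "cayley_isomorphic M (mat_M1' a b c)"
    with mat_M1'_shift show ?thesis by (rule linearly_edge_transitive_of_shift)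
  qed
qed

end
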